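(* The numbers $a_t^C(K_n)$ of time-dependent assembly trees satisfying the connected gluing rule for the complete graphs $K_n$ satisfy $a^C_t(K_1)=a^C_t(K_2)=1$ and, for every integer $n\ge 3$, $$a^C_t(K_n)=\sum_{j=1}^{n-1}S_2(n,j)\,a^C_t(K_j),$$ where $S_2(n,j)$ denotes the Stirling number of the second kind.
   Context: All graphs are finite and simple. Let $G=(V,E)$ be a connected graph with $|V|=N\ge 2$. A time-dependent assembly tree for $G$ is a rooted (unordered) tree each of whose nodes is labeled by a pair $(U,i)$ with $U\subseteq V$ and $i$ a nonnegative integer, such that: (1) the leaves are exactly $N$ in number, labeled $(v,0)$, one for each vertex $v\in V$ ($v$ identified with $\{v\}$); (2) each internal (non-leaf) node has at least two children; (3) the root is labeled $(V,m)$ for some $1\le m\le N-1$; (4) for each internal node $(U,i)$, $U$ is the union of the vertex sets labeling its children (equivalently, the set of leaves below it); (5) if $(U,i)$ and $(U',i')$ are adjacent nodes with $U\subseteq U'$, then $i<i'$; (6) for each $0\le i\le m$ there exists a node labeled $(U,i)$ for some $U\subseteq V$. For $N=1$, by convention the only time-dependent assembly tree is the single node $(v,0)$. Two such trees are the same if there is a label-preserving isomorphism of rooted trees between them. Such a tree satisfies the connected gluing rule if for each internal node $(U,i)$ the subgraph of $G$ induced by $U$ is connected. $a_t^C(G)$ is the number of time-dependent assembly trees for $G$ satisfying the connected gluing rule. $K_n$ is the complete graph on $n$ vertices. *)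

theory Defs
  imports
    "Graph_Theory.Graph_Theory"
    "HOL-Library.Multiset"
    "HOL-Combinatorics.Stirling"
begin

text \<open>
  Finite rooted unordered trees whose nodes are labelled by pairs \<open>(U, i)\<close>. The children of a
  node form a multiset of trees, so elements of this type are rooted trees up to label-preserving
  isomorphism: two trees are isomorphic as labelled rooted trees iff they are equal.
\<close>

datatype 'v ltree = LNode (label: "'v set \<times> nat") (children: "'v ltree multiset")

abbreviation vset :: "'v ltree \<Rightarrow> 'v set" where
  "vset s \<equiv> fst (label s)"

abbreviation stage :: "'v ltree \<Rightarrow> nat" where
  "stage s \<equiv> snd (label s)"

text \<open>
  Nodes are represented by the subtrees rooted at them; \<open>nodes t\<close> has one element, counted with
  multiplicity, for every node of \<open>t\<close> (the root and the leaves included).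
\<close>

primrec nodes :: "'v ltree \<Rightarrow> 'v ltree multiset" where
  "nodes (LNode l ts) = add_mset (LNode l ts) (\<Sum>\<^sub># (image_mset nodes ts))"

definition is_leaf :: "'v ltree \<Rightarrow> bool" where
  "is_leaf s \<longleftrightarrow> children s = {#}"

definition adjacent_nodes :: "'v ltree \<Rightarrow> 'v ltree \<Rightarrow> 'v ltree \<Rightarrow> bool" where
  "adjacent_nodes t x y \<longleftrightarrow>
     x \<in># nodes t \<and> y \<in># nodes t \<and> (x \<in># children y \<or> y \<in># children x)"

text \<open>
  Meant for connected simple graphs \<open>G\<close> (\<open>graph G\<close> and \<open>connected G\<close>). A graph with one vertex is
  treated separately, by convention. The multiset equation says that there is exactly one leaf per
  vertex \<open>v\<close>, with label \<open>({v}, 0)\<close>, and no other leaf.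
\<close>

definition assembly_tree :: "('v, 'e) pre_digraph \<Rightarrow> 'v ltree \<Rightarrow> bool" where
  "assembly_tree G t \<longleftrightarrow>
     (if card (verts G) = 1 then t = LNode (verts G, 0) {#}
      else
        (\<forall>s \<in># nodes t. vset s \<subseteq> verts G) \<and>
        image_mset label (filter_mset is_leaf (nodes t))
          = image_mset (\<lambda>v. ({v}, 0)) (mset_set (verts G)) \<and>
        (\<forall>s \<in># nodes t. \<not> is_leaf s \<longrightarrow> 2 \<le> size (children s)) \<and>
        (\<forall>s \<in># nodes t. \<not> is_leaf s \<longrightarrow> vset s = (\<Union>c \<in> set_mset (children s). vset c)) \<and>
        (\<forall>x y. adjacent_nodes t x y \<and> vset x \<subseteq> vset y \<longrightarrow> stage x < stage y) \<and>
        (\<exists>m. 1 \<le> m \<and> m \<le> card (verts G) - 1 \<and> label t = (verts G, m) \<and>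
             (\<forall>i \<le> m. \<exists>s \<in># nodes t. stage s = i)))"

definition connected_gluing :: "('v, 'e) pre_digraph \<Rightarrow> 'v ltree \<Rightarrow> bool" where
  "connected_gluing G t \<longleftrightarrow> (\<forall>s \<in># nodes t. \<not> is_leaf s \<longrightarrow> connected (G \<restriction> vset s))"

definition num_connected_assembly_trees :: "('v, 'e) pre_digraph \<Rightarrow> nat" (\<open>a\<^sub>t\<^sup>C\<close>) where
  "a\<^sub>t\<^sup>C G = card {t. assembly_tree G t \<and> connected_gluing G t}"

definition complete_graph :: "nat \<Rightarrow> (nat, nat \<times> nat) pre_digraph" where
  "complete_graph n =
     with_proj \<lparr>pverts = {..<n}, parcs = {(u, v). u < n \<and> v < n \<and> u \<noteq> v}\<rparr>"

lemma complete_digraph_complete_graph: "complete_digraph n (complete_graph n)"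
  unfolding complete_graph_def complete_digraph_pair_def by auto

end

theory Submission
  imports Defs "HOL-Library.Disjoint_Sets"
begin

text \<open>
  Every nonempty induced subgraph of a complete graph is connected, so the trees to be counted are
  all assembly trees on \<open>n\<close> vertices. The recurrence comes from looking at what has been assembled
  at time \<open>1\<close>. An internal node at time \<open>1\<close> has only leaves below it, so the nodes at time \<open>1\<close>,
  together with the vertices not yet used, form a partition \<open>P\<close> of the vertex set. Some node does
  have time \<open>1\<close>, so \<open>P\<close> has \<open>j < n\<close> blocks. Turning every block into a single leaf and lowering all
  other times by one gives an assembly tree whose vertices are the blocks of \<open>P\<close>. Conversely, any
  assembly tree on the blocks can be expanded again. There are \<open>S\<^sub>2(n, j)\<close> partitions into \<open>j\<close> blocks
  (\<open>card_partitions_eq_Stirling\<close>), and the number of trees depends only on the number of vertices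
  (\<open>bij_betw_timed_trees\<close>), which gives the summand \<open>S\<^sub>2(n, j) a(j)\<close>.

  For the formal argument the assembly trees are first described by conditions that are local to a
  node and its children (\<open>timed_tree\<close>) plus two global ones: the leaves are the vertices, each
  once, and no time step is empty. That this is the same notion is \<open>assembly_tree_iff_timed_trees\<close>.
  The bijection is \<open>bij_betw_expand\<close>. The map \<open>expand\<close> goes from trees whose vertices are sets to
  trees whose vertices are the elements of these sets. It is one function for all \<open>P\<close>, because the
  blocks can be read off the leaves of its argument. The one-vertex graph fits into the same
  description, and the recurrence already holds for \<open>n = 2\<close>, where its right-hand side is
  \<open>S\<^sub>2(2, 1) a(1) = 1\<close>.
\<close>

section \<open>Set partitions and Stirling numbers\<close>

lemma partition_on_remove:
  assumes "partition_on A P" "B \<in> P"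
  shows "partition_on (A - B) (P - {B})" "disjnt B (\<Union>(P - {B}))" "B \<subseteq> A" "B \<noteq> {}"
proof -
  show disj: "disjnt B (\<Union>(P - {B}))"
    using assms partition_onD2[OF assms(1)] by (auto simp: disjnt_def dest: disjointD)
  have "partition_on A (insert B (P - {B}))"
    using assms by (simp add: insert_absorb)
  then show "partition_on (A - B) (P - {B})" "B \<subseteq> A" "B \<noteq> {}"
    using partition_on_insert[OF disj] by blast+
qed

text \<open>
  The recursion of the Stirling numbers counts the partitions of \<open>insert a A\<close> by the block of \<open>a\<close>: it is
  either \<open>{a}\<close>, added to a partition of \<open>A\<close>, or arises by inserting \<open>a\<close> into one of the blocks of a
  partition of \<open>A\<close>.
\<close>

lemma card_partitions_eq_Stirling:
  assumes "finite A"
  shows "card {P. partition_on A P \<and> card P = k} = Stirling (card A) k"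
  using assms
proof (induction A arbitrary: k rule: finite_induct)
  case empty
  have "{P :: 'a set set. partition_on {} P \<and> card P = k} = (if k = 0 then {{}} else {})"
    by (auto simp: partition_on_empty)
  then have "card {P :: 'a set set. partition_on {} P \<and> card P = k} = (if k = 0 then 1 else 0)"
    by simp
  then show ?case by (cases k) simp_all
next
  case (insert a A)
  let ?parts = "\<lambda>A k. {P. partition_on A P \<and> card P = k}"
  have fin: "finite Q" if "partition_on A Q" for Q
    using finite_elements insert.hyps(1) that by blast
  have sub: "B \<subseteq> A" "a \<notin> B" if "partition_on A Q" "B \<in> Q" for Q B
    using that insert.hyps(2) by (auto dest: partition_onD1)
  show ?case
  proof (cases k)
    case 0
    have "?parts (insert a A) 0 = {}"
    proof (intro equals0I)
      fix P assume "P \<in> ?parts (insert a A) 0"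
      moreover from this have "finite P"
        using finite_elements insert.hyps(1) by blast
      ultimately show False by (auto dest: partition_onD1)
    qed
    then have "card (?parts (insert a A) 0) = 0" by (simp only: card.empty)
    also have "0 = Stirling (card (insert a A)) 0" using insert.hyps by simp
    finally show ?thesis unfolding 0 .
  next
    case (Suc l)
    \<comment> \<open>\<open>L\<close> collects the partitions with \<open>{a}\<close> as a block.
      \<open>R\<close> collects those where \<open>a\<close> joins the block \<open>B\<close> of \<open>Q\<close>.\<close>
    define L where "L = insert {a} ` ?parts A l"
    define f where "f = (\<lambda>(Q, B). insert (insert a B) (Q - {B}) :: 'a set set)"
    define R where "R = f ` (SIGMA Q: ?parts A (Suc l). Q)"
    have "inj_on (insert {a}) (?parts A l)"
    proof (rule inj_onI)
      fix P Q assume PQ: "P \<in> ?parts A l" "Q \<in> ?parts A l" "insert {a} P = insert {a} Q"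
      then have "{a} \<notin> P" "{a} \<notin> Q" using sub(2) by auto
      then show "P = Q" using PQ(3) by (metis insert_ident)
    qed
    then have cardL: "card L = Stirling (card A) l"
      unfolding L_def using insert.IH by (simp add: card_image)
    have injf: "inj_on f (SIGMA Q: ?parts A (Suc l). Q)"
    proof (rule inj_onI, clarify)
      fix P B Q C
      assume P: "partition_on A P" "B \<in> P" and Q: "partition_on A Q" "C \<in> Q"
        and eq: "f (P, B) = f (Q, C)"
      have notP: "\<forall>D\<in>P. a \<notin> D" and notQ: "\<forall>D\<in>Q. a \<notin> D"
        using sub(2) P(1) Q(1) by auto
      from eq have eq': "insert (insert a B) (P - {B}) = insert (insert a C) (Q - {C})"
        by (simp add: f_def)
      then have "insert a B \<in> insert (insert a C) (Q - {C})" by blast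
      then have "insert a B = insert a C" using notQ by blast
      then have BC: "B = C" using notP notQ P(2) Q(2) by (metis insert_ident)
      have "P - {B} = Q - {C}"
        using eq' BC notP notQ by (metis DiffD1 insertI1 insert_ident)
      then show "P = Q \<and> B = C" using BC P(2) Q(2) by blast
    qed
    have "card R = card (SIGMA Q: ?parts A (Suc l). Q)"
      unfolding R_def by (rule card_image[OF injf])
    also have "\<dots> = (\<Sum>Q\<in>?parts A (Suc l). card Q)"
      using fin finitely_many_partition_on[OF insert.hyps(1)]
      by (intro card_SigmaI) auto
    also have "\<dots> = Suc l * Stirling (card A) (Suc l)"
      using insert.IH by simp
    finally have cardR: "card R = Suc l * Stirling (card A) (Suc l)" .
    have "L \<inter> R = {}"
    proof (intro equals0I)
      fix P assume "P \<in> L \<inter> R"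
      then have aP: "{a} \<in> P" and "P \<in> R" by (auto simp: L_def)
      then obtain Q B where *: "{a} \<in> P" "partition_on A Q" "B \<in> Q"
        "P = insert (insert a B) (Q - {B})"
        by (auto simp: R_def f_def)
      then have "B \<noteq> {}" "a \<notin> B" "{a} \<notin> Q"
        using sub(2) partition_onD3[OF *(2)] by auto
      then show False using * by auto
    qed
    moreover have "?parts (insert a A) (Suc l) = L \<union> R"
    proof (intro equalityI subsetI)
      fix P assume "P \<in> ?parts (insert a A) (Suc l)"
      then have P: "partition_on (insert a A) P" "card P = Suc l" by auto
      then have finP: "finite P" using card.infinite by fastforce
      obtain C where C: "C \<in> P" "a \<in> C" using partition_onD1[OF P(1)] by auto
      note rem = partition_on_remove[OF P(1) C(1)]
      show "P \<in> L \<union> R"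
      proof (cases "C = {a}")
        case True
        have "insert a A - C = A" using True insert.hyps(2) by simp
        then have "partition_on A (P - {C})" using rem(1) by simp
        moreover have "card (P - {C}) = l" using C finP P(2) by simp
        moreover have "P = insert {a} (P - {C})" using C True by blast
        ultimately have "P \<in> L" unfolding L_def by blast
        then show ?thesis by simp
      next
        case False
        define B where "B = C - {a}"
        have B: "B \<noteq> {}" "insert a B = C" "a \<notin> B" using False C by (auto simp: B_def)
        have disj: "disjnt B (\<Union>(P - {C}))" using rem(2) B(2) by (auto simp: disjnt_def)
        then have BP: "B \<notin> P - {C}" using B(1) by (auto simp: disjnt_def)
        have "A - B = insert a A - C" "B \<subseteq> A" using B rem(3) insert.hyps(2) by auto
        then have "partition_on A (insert B (P - {C}))"
          using partition_on_insert[OF disj] rem(1) B(1) by simp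
        moreover have "card (insert B (P - {C})) = Suc l"
          using BP finP P(2) C card_Suc_Diff1[OF finP C(1)] by simp
        moreover have "P = f (insert B (P - {C}), B)"
          using BP C B by (auto simp: f_def)
        ultimately have "P \<in> R" unfolding R_def
          by (intro image_eqI[of _ _ "(insert B (P - {C}), B)"]) auto
        then show ?thesis by simp
      qed
    next
      fix P assume "P \<in> L \<union> R"
      then show "P \<in> ?parts (insert a A) (Suc l)"
      proof
        assume "P \<in> L"
        then obtain Q where Q: "partition_on A Q" "card Q = l" "P = insert {a} Q"
          by (auto simp: L_def)
        then have "{a} \<notin> Q" using sub(2)[OF Q(1), of "{a}"] by blast
        then have "card P = Suc l" using Q fin by simp
        moreover have "partition_on (insert a A) P"
          unfolding Q(3) using Q(1) insert.hyps(2) partition_onD1[OF Q(1)]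
          by (subst partition_on_insert) (auto simp: disjnt_def)
        ultimately show ?thesis by simp
      next
        assume "P \<in> R"
        then obtain Q B where Q: "partition_on A Q" "card Q = Suc l" "B \<in> Q"
          "P = insert (insert a B) (Q - {B})"
          by (auto simp: R_def f_def)
        note rem = partition_on_remove[OF Q(1,3)]
        have "insert a B \<notin> Q" using sub(2)[OF Q(1)] by blast
        then have "card P = Suc l"
          using Q(2-4) fin[OF Q(1)] card_Suc_Diff1[OF fin[OF Q(1)] Q(3)] by simp
        moreover have "disjnt (insert a B) (\<Union>(Q - {B}))"
          using rem(2) sub(2)[OF Q(1)] by (auto simp: disjnt_def)
        then have "partition_on (insert a A) P"
          unfolding Q(4) using rem(1,3) insert.hyps(2)
          by (subst partition_on_insert) auto
        ultimately show ?thesis by simp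
      qed
    qed
    moreover have "finite L" "finite R"
      using finitely_many_partition_on[OF insert.hyps(1)] fin
      by (auto simp: L_def R_def intro!: finite_imageI finite_SigmaI)
    ultimately have "card (?parts (insert a A) (Suc l)) = card L + card R"
      by (simp add: card_Un_disjoint)
    then show ?thesis using cardL cardR insert.hyps Suc by simp
  qed
qed

lemma sum_mset_set_disjoint:
  assumes "finite P" "\<forall>B\<in>P. finite B" "disjoint P"
  shows "(\<Sum>B\<in>#mset_set P. mset_set B) = mset_set (\<Union>P)"
  using assms
proof (induction P rule: finite_induct)
  case (insert B P)
  have "B \<inter> \<Union>P = {}" using insert by (auto simp: disjoint_def)
  moreover have "disjoint P" using insert.prems by (auto simp: disjoint_def)
  ultimately show ?case using insert by (simp add: mset_set_Union)
qed simp

text \<open>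
  A multiset of sets covering every element of \<open>V\<close> exactly once has no repeated and no overlapping
  members. In this way the leaf multiset of a tree of blocks is recognised as a partition.
\<close>

lemma partition_if_sum_mset_set:
  assumes "\<forall>B\<in>#M. finite B \<and> B \<noteq> {}" "(\<Sum>B\<in>#M. mset_set B) = mset_set V" "finite V"
  shows "partition_on V (set_mset M)" "M = mset_set (set_mset M)"
proof -
  have le: "count (\<Sum>B\<in>#M. mset_set B) v \<le> 1" for v
    using assms(2,3) by (simp add: count_mset_set')
  have twice: "B \<inter> C = {}" if "M = {#B, C#} + M'" for B C M'
  proof (rule equals0I)
    fix v assume "v \<in> B \<inter> C"
    then show False using assms(1) le[of v] by (simp add: that)
  qed
  show "M = mset_set (set_mset M)"
  proof (rule multiset_eqI)
    fix B
    have "count M B \<le> 1"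
    proof (rule ccontr)
      assume "\<not> count M B \<le> 1"
      then have "{#B, B#} \<subseteq># M"
        by (intro mset_subset_eqI) auto
      then obtain M' where "M = {#B, B#} + M'" by (metis subset_mset.le_iff_add)
      with twice assms(1) show False by fastforce
    qed
    then show "count M B = count (mset_set (set_mset M)) B"
      by (cases "B \<in># M")
        (auto simp: count_mset_set' le_antisym not_in_iff simp flip: count_greater_zero_iff)
  qed
  show "partition_on V (set_mset M)"
  proof (rule partition_onI)
    have "set_mset (\<Sum>B\<in>#M. mset_set B) = V" using assms(2,3) by simp
    moreover have "set_mset (\<Sum>B\<in>#M. mset_set B) = \<Union>(set_mset M)" using assms(1) by auto
    ultimately show "\<Union>(set_mset M) = V" by simp
    show "{} \<notin> set_mset M" using assms(1) by blast
    show "disjnt p q" if pq: "p \<in># M" "q \<in># M" "p \<noteq> q" for p q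
    proof -
      obtain M1 where M1: "M = add_mset p M1" using pq(1) by (meson multi_member_split)
      with pq obtain M2 where "M1 = add_mset q M2" by (metis insert_noteq_member multi_member_split)
      with M1 twice[of p q M2] show ?thesis by (simp add: disjnt_def)
    qed
  qed
qed

lemma partition_on_elem:
  "finite V \<Longrightarrow> partition_on V P \<Longrightarrow> \<forall>B\<in>P. finite B \<and> B \<noteq> {}"
  by (metis Sup_upper finite_subset partition_onD1 partition_onD3)

text \<open>
  The cardinality of \<open>V\<close> exceeds that of \<open>P\<close> by the sum of \<open>card B - 1\<close> over the blocks \<open>B\<close>.
\<close>

lemma card_partition_less_iff:
  assumes "finite V" "partition_on V P"
  shows "card P < card V \<longleftrightarrow> \<not> (\<forall>B\<in>P. is_singleton B)"
proof -
  have P: "finite P" "\<forall>B\<in>P. finite B \<and> B \<noteq> {}"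
    using assms finite_elements partition_on_elem by blast+
  have "card V = (\<Sum>B\<in>P. card B)"
    using assms P product_partition by metis
  also have "\<dots> = (\<Sum>B\<in>P. 1 + (card B - 1))"
    using P by (intro sum.cong) (auto simp: card_gt_0_iff Suc_leI)
  also have "\<dots> = card P + (\<Sum>B\<in>P. card B - 1)"
    by (subst sum.distrib) simp
  finally have "card P < card V \<longleftrightarrow> (\<Sum>B\<in>P. card B - 1) \<noteq> 0"
    by linarith
  then have "card P < card V \<longleftrightarrow> (\<exists>B\<in>P. card B - 1 \<noteq> 0)"
    using P(1) by (simp only: sum_eq_0_iff) simp
  moreover have "card B - 1 \<noteq> 0 \<longleftrightarrow> \<not> is_singleton B" if "B \<in> P" for B
  proof -
    have "0 < card B" using P that by (simp add: card_gt_0_iff)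
    then show ?thesis by (auto simp: is_singleton_altdef)
  qed
  ultimately show ?thesis by auto
qed

lemma card_partition_pos:
  "finite V \<Longrightarrow> V \<noteq> {} \<Longrightarrow> partition_on V P \<Longrightarrow> 0 < card P"
  by (metis Union_empty card_gt_0_iff finite_elements partition_onD1)

section \<open>Timed trees\<close>

text \<open>
  The requirements on an assembly tree that concern a node and its children only, gathered in a form
  that admits rule induction.
\<close>

inductive timed_tree :: "'v ltree \<Rightarrow> bool" where
  leaf: "timed_tree (LNode ({v}, 0) {#})"
| node: "2 \<le> size ts \<Longrightarrow> \<forall>c\<in>#ts. timed_tree c \<and> stage c < i \<Longrightarrow>
    timed_tree (LNode (\<Union>c\<in>set_mset ts. vset c, i) ts)"

text \<open>
  A multiset, so that it also records whether a vertex occurs in several leaves.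
\<close>

primrec leaf_vertices :: "'v ltree \<Rightarrow> 'v multiset" where
  "leaf_vertices (LNode l ts) =
     (if ts = {#} then mset_set (fst l) else \<Sum>\<^sub># (image_mset leaf_vertices ts))"

primrec stages :: "'v ltree \<Rightarrow> nat set" where
  "stages (LNode l ts) = insert (snd l) (\<Union>(set_mset (image_mset stages ts)))"

definition timed_trees :: "'v set \<Rightarrow> 'v ltree set" where
  "timed_trees V =
     {t. timed_tree t \<and> leaf_vertices t = mset_set V \<and> {..stage t} \<subseteq> stages t}"

lemma timed_tree_leaf_iff [simp]:
  "timed_tree (LNode (U, i) {#}) \<longleftrightarrow> i = 0 \<and> is_singleton U"
  by (subst timed_tree.simps) (auto simp: is_singleton_def)

lemma timed_tree_node_iff:
  "ts \<noteq> {#} \<Longrightarrow> timed_tree (LNode (U, i) ts) \<longleftrightarrow>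
     2 \<le> size ts \<and> (\<forall>c\<in>#ts. timed_tree c \<and> stage c < i) \<and> U = (\<Union>c\<in>set_mset ts. vset c)"
  by (subst timed_tree.simps) auto

lemma set_leaf_vertices: "timed_tree t \<Longrightarrow> set_mset (leaf_vertices t) = vset t"
  by (induction rule: timed_tree.induct) auto

lemma leaf_vertices_nonempty: "timed_tree t \<Longrightarrow> leaf_vertices t \<noteq> {#}"
proof (induction rule: timed_tree.induct)
  case (node ts i)
  then obtain c where "c \<in># ts" by fastforce
  with node show ?case by auto
qed simp

lemma timed_tree_stage_zero:
  assumes "timed_tree t" "stage t = 0"
  obtains v where "t = LNode ({v}, 0) {#}"
  using assms(1)
proof (cases rule: timed_tree.cases)
  case (node ts i)
  then obtain c where "c \<in># ts" by fastforce
  with node assms(2) show ?thesis by auto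
qed (use that in blast)

lemma stage_zero_iff_leaf: "timed_tree t \<Longrightarrow> stage t = 0 \<longleftrightarrow> children t = {#}"
  by (metis ltree.collapse ltree.sel(2) prod.collapse timed_tree_leaf_iff timed_tree_stage_zero)

lemma stage_in_stages: "stage t \<in> stages t"
  by (cases t) simp

lemma finite_stages: "finite (stages t)"
  by (induction t) auto

lemma zero_in_stages: "timed_tree t \<Longrightarrow> 0 \<in> stages t"
proof (induction rule: timed_tree.induct)
  case (node ts i)
  then obtain c where "c \<in># ts" by fastforce
  with node show ?case by auto
qed simp

lemma leaf_vertices_child: "c \<in># ts \<Longrightarrow> leaf_vertices c \<subseteq># leaf_vertices (LNode l ts)"
  by (auto dest: multi_member_split)

text \<open>
  A tree has fewer internal nodes than leaves, since every internal node joins at least two subtrees,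
  and only internal nodes have positive times. It follows that the time of the root of an assembly
  tree on \<open>N\<close> vertices is at most \<open>N - 1\<close>.
\<close>

lemma card_positive_stages:
  assumes "timed_tree t"
  shows "card (stages t - {0}) < size (leaf_vertices t)"
  using assms
proof (induction rule: timed_tree.induct)
  case (leaf v)
  then show ?case by simp
next
  case (node ts i)
  let ?S = "\<lambda>c. stages c - {0}"
  let ?U = "\<lambda>ts. \<Union>c\<in>set_mset ts. ?S c"
  \<comment> \<open>Each child has fewer positive times than leaves, so every child
    contributes a surplus of at least one.\<close>
  have *: "card (?U ts) + size ts \<le> size (\<Sum>\<^sub># (image_mset leaf_vertices ts))"
    using node.IH
  proof (induction ts)
    case (add c ts)
    have "card (?U (add_mset c ts)) \<le> card (?S c) + card (?U ts)"
      using card_Un_le[of "?S c" "?U ts"] by simp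
    with add show ?case by auto
  qed simp
  have "stages (LNode (\<Union>c\<in>set_mset ts. vset c, i) ts) - {0} \<subseteq> insert i (?U ts)"
    by auto
  then have "card (stages (LNode (\<Union>c\<in>set_mset ts. vset c, i) ts) - {0}) \<le> card (insert i (?U ts))"
    by (intro card_mono) (auto simp: finite_stages)
  also have "\<dots> \<le> Suc (card (?U ts))"
    by (simp add: card_insert_le_m1 card_insert_if)
  finally show ?case using * node.hyps by auto
qed

lemma vset_timed_trees: "finite V \<Longrightarrow> t \<in> timed_trees V \<Longrightarrow> vset t = V"
  using set_leaf_vertices[of t] by (simp add: timed_trees_def)

lemma timed_trees_singleton: "timed_trees {v} = {LNode ({v}, 0) {#}}"
proof (intro equalityI subsetI)
  fix t assume t: "t \<in> timed_trees {v}"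
  then have "card (stages t - {0}) = 0"
    using card_positive_stages[of t] by (simp add: timed_trees_def)
  then have "stage t = 0" using stage_in_stages[of t] finite_stages[of t] by auto
  moreover have "timed_tree t" using t by (simp add: timed_trees_def)
  ultimately obtain w where "t = LNode ({w}, 0) {#}" by (metis timed_tree_stage_zero)
  then show "t \<in> {LNode ({v}, 0) {#}}" using t by (simp add: timed_trees_def)
qed (auto simp: timed_trees_def)

section \<open>Timed trees are the assembly trees of complete graphs\<close>

lemma self_in_nodes: "t \<in># nodes t"
  by (cases t) simp

lemma children_in_nodes: "s \<in># nodes t \<Longrightarrow> c \<in># children s \<Longrightarrow> c \<in># nodes t"
  by (induction t) (auto intro: self_in_nodes)

lemma stages_eq_nodes: "stages t = stage ` set_mset (nodes t)"
  by (induction t) (auto simp: image_UN)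

lemma timed_tree_nodes: "timed_tree t \<Longrightarrow> s \<in># nodes t \<Longrightarrow> timed_tree s"
  by (induction rule: timed_tree.induct) (auto intro: timed_tree.intros)

lemma leaf_vertices_nodes: "s \<in># nodes t \<Longrightarrow> leaf_vertices s \<subseteq># leaf_vertices t"
proof (induction t)
  case (LNode l ts)
  show ?case
  proof (cases "s = LNode l ts")
    case False
    with LNode.prems obtain c where c: "c \<in># ts" "s \<in># nodes c" by auto
    then show ?thesis
      using LNode.IH leaf_vertices_child[OF c(1)] subset_mset.order_trans by blast
  qed simp
qed

lemma leaf_labels:
  assumes "timed_tree t"
  shows "image_mset label (filter_mset is_leaf (nodes t)) = image_mset (\<lambda>v. ({v}, 0)) (leaf_vertices t)"
  using assms
proof (induction rule: timed_tree.induct)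
  case (node ts i)
  have "ts \<noteq> {#}" using node by auto
  moreover have "image_mset label (filter_mset is_leaf (\<Sum>\<^sub># (image_mset nodes ts))) =
     image_mset (\<lambda>v. ({v}, 0)) (\<Sum>\<^sub># (image_mset leaf_vertices ts))"
    using node.IH by (induction ts) auto
  moreover have "\<not> is_leaf (LNode (\<Union>c\<in>set_mset ts. vset c, i) ts)"
    using \<open>ts \<noteq> {#}\<close> by (simp add: is_leaf_def)
  ultimately show ?case by simp
qed (simp add: is_leaf_def)

text \<open>
  The conditions are phrased for all nodes of one fixed tree, as in the definition of assembly trees.
\<close>

lemma timed_treeI:
  assumes "\<And>s. s \<in># nodes t \<Longrightarrow> is_leaf s \<Longrightarrow> \<exists>v. label s = ({v}, 0)"
    and "\<And>s. s \<in># nodes t \<Longrightarrow> \<not> is_leaf s \<Longrightarrow> 2 \<le> size (children s)"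
    and "\<And>s. s \<in># nodes t \<Longrightarrow> \<not> is_leaf s \<Longrightarrow> vset s = (\<Union>c \<in> set_mset (children s). vset c)"
    and "\<And>s c. s \<in># nodes t \<Longrightarrow> c \<in># children s \<Longrightarrow> stage c < stage s"
  shows "timed_tree t"
  using assms
proof (induction t)
  case (LNode l ts)
  obtain U i where l: "l = (U, i)" by fastforce
  have child: "nodes c \<subseteq># nodes (LNode l ts)" if "c \<in># ts" for c
    using that by (auto dest!: multi_member_split intro: subset_mset.add_increasing)
  note self = self_in_nodes[of "LNode l ts"]
  show ?case
  proof (cases "ts = {#}")
    case True
    then show ?thesis using LNode.prems(1)[OF self] l by (auto simp: is_leaf_def)
  next
    case False
    have "timed_tree c" if c: "c \<in># ts" for c
    proof (rule LNode.IH[OF c])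
      fix s assume "s \<in># nodes c"
      then have s: "s \<in># nodes (LNode l ts)" using child[OF c] by (rule mset_subset_eqD[rotated])
      show "is_leaf s \<Longrightarrow> \<exists>v. label s = ({v}, 0)" using LNode.prems(1)[OF s] .
      show "\<not> is_leaf s \<Longrightarrow> 2 \<le> size (children s)" using LNode.prems(2)[OF s] .
      show "\<not> is_leaf s \<Longrightarrow> vset s = (\<Union>c \<in> set_mset (children s). vset c)"
        using LNode.prems(3)[OF s] .
      show "stage c' < stage s" if "c' \<in># children s" for c' using LNode.prems(4)[OF s that] .
    qed
    then show ?thesis
      using False l LNode.prems(2,3)[OF self] LNode.prems(4)[OF self]
      by (simp add: timed_tree_node_iff is_leaf_def)
  qed
qed

text \<open>
  A sibling of \<open>c\<close> has a leaf, and its vertex cannot occur below \<open>c\<close> as well. Strictness rules out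
  that a parent and a child have the same vertex set, in which case the condition on the times of
  adjacent nodes would apply to them in both directions.
\<close>

lemma child_vset_psubset:
  assumes "timed_tree s" "\<And>v. count (leaf_vertices s) v \<le> 1" "c \<in># children s"
  shows "vset c \<subset> vset s"
proof -
  obtain U i ts where s: "s = LNode (U, i) ts" by (metis ltree.exhaust surj_pair)
  then have "c \<in># ts" "ts \<noteq> {#}" using assms(3) by auto
  with assms(1) have ts: "2 \<le> size ts" "c \<in># ts" "U = (\<Union>c\<in>set_mset ts. vset c)"
    "\<forall>c\<in>#ts. timed_tree c"
    by (simp_all add: s timed_tree_node_iff)
  obtain ts' where ts': "ts = add_mset c ts'" using ts(2) by (meson multi_member_split)
  with ts(1) have "ts' \<noteq> {#}" by auto
  then obtain d where d: "d \<in># ts'" by blast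
  then obtain ts'' where ts'': "ts = add_mset c (add_mset d ts'')" using ts' by (metis multi_member_split)
  then have cd: "timed_tree c" "timed_tree d" using ts by auto
  obtain v where v: "v \<in># leaf_vertices d" using leaf_vertices_nonempty[OF cd(2)] by blast
  have "v \<notin># leaf_vertices c"
  proof
    assume "v \<in># leaf_vertices c"
    then have "0 < count (leaf_vertices c) v" "0 < count (leaf_vertices d) v" using v by simp_all
    moreover have "count (leaf_vertices c) v + count (leaf_vertices d) v \<le> 1"
      using assms(2)[of v] by (simp add: s ts'')
    ultimately show False by linarith
  qed
  then have "v \<in> vset d" "v \<notin> vset c" using v cd set_leaf_vertices by blast+
  then show ?thesis using s ts ts'' by auto
qed

text \<open>
  For one vertex both sides describe the single leaf. For more vertices the multiset of leaf labels
  determines the leaf vertices because labelling is injective. The bound on the time of the root comes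
  from \<open>card_positive_stages\<close>.
\<close>

lemma assembly_tree_iff_timed_trees:
  assumes "finite (verts G)" "verts G \<noteq> {}"
  shows "assembly_tree G t \<longleftrightarrow> t \<in> timed_trees (verts G)"
proof (cases "card (verts G) = 1")
  case True
  then obtain v where "verts G = {v}" by (auto simp: card_1_singleton_iff)
  then show ?thesis by (simp add: assembly_tree_def timed_trees_singleton)
next
  case False
  then have card: "2 \<le> card (verts G)" using assms by (metis One_nat_def Suc_1 Suc_leI card_gt_0_iff nat_less_le)
  let ?leaf = "\<lambda>v. ({v}, 0::nat)"
  have inj: "inj ?leaf" by (auto simp: inj_def)
  show ?thesis
  proof
    assume A: "assembly_tree G t"
    then have leaves: "image_mset label (filter_mset is_leaf (nodes t)) = image_mset ?leaf (mset_set (verts G))"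
      and size: "\<forall>s \<in># nodes t. \<not> is_leaf s \<longrightarrow> 2 \<le> size (children s)"
      and union: "\<forall>s \<in># nodes t. \<not> is_leaf s \<longrightarrow> vset s = (\<Union>c \<in> set_mset (children s). vset c)"
      and adj: "\<forall>x y. adjacent_nodes t x y \<and> vset x \<subseteq> vset y \<longrightarrow> stage x < stage y"
      and root: "\<exists>m. label t = (verts G, m) \<and> (\<forall>i \<le> m. \<exists>s \<in># nodes t. stage s = i)"
      using False by (auto simp: assembly_tree_def)
    have t: "timed_tree t"
    proof (rule timed_treeI)
      fix s assume s: "s \<in># nodes t"
      show "\<exists>v. label s = ({v}, 0)" if "is_leaf s"
      proof -
        have "label s \<in># image_mset label (filter_mset is_leaf (nodes t))" using s that by auto
        then show ?thesis using leaves by auto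
      qed
      show "stage c < stage s" if c: "c \<in># children s" for c
      proof -
        have "\<not> is_leaf s" using c by (auto simp: is_leaf_def)
        then have "vset c \<subseteq> vset s" using union s c by blast
        moreover have "adjacent_nodes t c s"
          using s c children_in_nodes by (auto simp: adjacent_nodes_def)
        ultimately show ?thesis using adj by blast
      qed
    qed (use size union in auto)
    moreover have "leaf_vertices t = mset_set (verts G)"
    proof (rule multiset.inj_map_strong[of _ _ ?leaf ?leaf])
      show "image_mset ?leaf (leaf_vertices t) = image_mset ?leaf (mset_set (verts G))"
        using leaf_labels[OF t] leaves by simp
    qed auto
    moreover have "{..stage t} \<subseteq> stages t"
      using root by (force simp: stages_eq_nodes)
    ultimately show "t \<in> timed_trees (verts G)" by (simp add: timed_trees_def)
  next
    assume T: "t \<in> timed_trees (verts G)"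
    then have t: "timed_tree t" "leaf_vertices t = mset_set (verts G)" "{..stage t} \<subseteq> stages t"
      by (auto simp: timed_trees_def)
    have vt: "vset t = verts G" using vset_timed_trees[OF assms(1) T] .
    have tn: "timed_tree s" if "s \<in># nodes t" for s using timed_tree_nodes[OF t(1) that] .
    have once: "count (leaf_vertices s) v \<le> 1" if "s \<in># nodes t" for s v
      using mset_subset_eq_count[OF leaf_vertices_nodes[OF that], of v] t(2)
      by (simp add: count_mset_set' split: if_splits)
    have inner: "2 \<le> size (children s) \<and> vset s = (\<Union>c \<in> set_mset (children s). vset c) \<and>
        (\<forall>c\<in>#children s. stage c < stage s)" if "s \<in># nodes t" "\<not> is_leaf s" for s
      using tn[OF that(1)] that(2) by (cases s; cases "label s") (auto simp: timed_tree_node_iff is_leaf_def)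
    have "\<forall>s \<in># nodes t. vset s \<subseteq> verts G"
      using leaf_vertices_nodes set_leaf_vertices tn t(1) vt
      by (metis set_mset_mono)
    moreover have "image_mset label (filter_mset is_leaf (nodes t)) = image_mset ?leaf (mset_set (verts G))"
      using leaf_labels[OF t(1)] t(2) by simp
    moreover have "stage x < stage y" if "adjacent_nodes t x y" "vset x \<subseteq> vset y" for x y
    proof -
      have xy: "x \<in># nodes t" "y \<in># nodes t" "x \<in># children y \<or> y \<in># children x"
        using that(1) by (auto simp: adjacent_nodes_def)
      then have "\<not> y \<in># children x"
        using child_vset_psubset[OF tn once] that(2) by blast
      then have "x \<in># children y" using xy by blast
      moreover from this have "\<not> is_leaf y" by (auto simp: is_leaf_def)
      ultimately show ?thesis using inner[OF xy(2)] by blast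
    qed
    moreover have "1 \<le> stage t"
    proof (rule ccontr)
      assume "\<not> 1 \<le> stage t"
      then obtain v where "t = LNode ({v}, 0) {#}" using timed_tree_stage_zero t(1) by (metis less_one not_le)
      then have "verts G = {v}" using vt by simp
      then show False using False by simp
    qed
    moreover have "stage t \<le> card (verts G) - 1"
    proof -
      have "{1..stage t} \<subseteq> stages t - {0}" using t(3) by auto
      then have "stage t \<le> card (stages t - {0})"
        using card_mono[of "stages t - {0}" "{1..stage t}"] finite_stages[of t] by simp
      also have "\<dots> < card (verts G)" using card_positive_stages[OF t(1)] t(2) by simp
      finally show ?thesis by simp
    qed
    moreover have "\<forall>i \<le> stage t. \<exists>s \<in># nodes t. stage s = i"
      using t(3) by (force simp: stages_eq_nodes)
    ultimately show "assembly_tree G t"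
      using False inner vt unfolding assembly_tree_def
      by (auto intro!: exI[of _ "stage t"] prod_eqI)
  qed
qed

text \<open>
  Any two distinct vertices are joined by an arc, so the connected gluing rule always holds.
\<close>

lemma connected_induce_complete_graph:
  assumes "U \<noteq> {}" "U \<subseteq> {..<n}"
  shows "connected (complete_graph n \<restriction> U)"
proof -
  have "(u, v) \<in> rtrancl_on U ((arcs_ends (complete_graph n \<restriction> U))\<^sup>s)"
    if "u \<in> U" "v \<in> U" for u v
  proof (cases "u = v")
    case False
    then have "(u, v) \<in> arcs_ends (complete_graph n \<restriction> U)"
      using that assms(2) by (auto simp: complete_graph_def arcs_ends_conv induce_subgraph_def)
    then have "(u, v) \<in> (arcs_ends (complete_graph n \<restriction> U))\<^sup>s"
      by (simp add: symcl_def)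
    with rtrancl_on_refl[OF that(1)] show ?thesis
      using that(2) by (rule rtrancl_on_into_rtrancl_on)
  qed (use that in auto)
  then show ?thesis using assms(1) by (simp add: connected_conv)
qed

lemma num_connected_assembly_trees_complete_graph:
  assumes "0 < n"
  shows "a\<^sub>t\<^sup>C (complete_graph n) = card (timed_trees {..<n})"
proof -
  have V: "verts (complete_graph n) = {..<n}" by (simp add: complete_graph_def)
  have "connected_gluing (complete_graph n) t" if "t \<in> timed_trees {..<n}" for t
    unfolding connected_gluing_def
  proof (intro ballI impI)
    fix s assume s: "s \<in># nodes t"
    have t: "timed_tree t" using that by (simp add: timed_trees_def)
    have "timed_tree s" using timed_tree_nodes[OF t s] .
    then have "vset s \<noteq> {}" "vset s \<subseteq> vset t"
      using leaf_vertices_nonempty leaf_vertices_nodes[OF s] t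
      by (metis set_leaf_vertices set_mset_eq_empty_iff, metis set_leaf_vertices set_mset_mono)
    then show "connected (complete_graph n \<restriction> vset s)"
      using vset_timed_trees[OF _ that] by (intro connected_induce_complete_graph) auto
  qed
  then have "{t. assembly_tree (complete_graph n) t \<and> connected_gluing (complete_graph n) t} = timed_trees {..<n}"
    using assembly_tree_iff_timed_trees[of "complete_graph n"] V assms by auto
  then show ?thesis by (simp add: num_connected_assembly_trees_def)
qed

section \<open>Renaming the vertices\<close>

primrec relabel :: "('v \<Rightarrow> 'w) \<Rightarrow> 'v ltree \<Rightarrow> 'w ltree" where
  "relabel f (LNode l ts) = LNode (f ` fst l, snd l) (image_mset (relabel f) ts)"

lemma label_relabel [simp]: "label (relabel f t) = (f ` vset t, stage t)"
  by (cases t) simp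

lemma timed_tree_relabel: "timed_tree t \<Longrightarrow> timed_tree (relabel f t)"
proof (induction rule: timed_tree.induct)
  case (node ts i)
  then have "ts \<noteq> {#}" by auto
  with node show ?case by (auto simp: timed_tree_node_iff)
qed simp

lemma stages_relabel [simp]: "stages (relabel f t) = stages t"
  by (induction t) auto

lemma image_mset_sum_mset_image:
  "image_mset f (\<Sum>\<^sub># (image_mset g M)) = (\<Sum>x\<in>#M. image_mset f (g x))"
  by (induction M) auto

lemma leaf_vertices_relabel:
  "timed_tree t \<Longrightarrow> leaf_vertices (relabel f t) = image_mset f (leaf_vertices t)"
proof (induction rule: timed_tree.induct)
  case (node ts i)
  then have "ts \<noteq> {#}" by auto
  moreover have "image_mset (leaf_vertices \<circ> relabel f) ts = image_mset (\<lambda>c. image_mset f (leaf_vertices c)) ts"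
    using node by (intro image_mset_cong) auto
  ultimately show ?case by (simp add: multiset.map_comp image_mset_sum_mset_image)
qed simp

lemma relabel_inverse:
  "timed_tree t \<Longrightarrow> (\<And>v. v \<in> vset t \<Longrightarrow> g (f v) = v) \<Longrightarrow> relabel g (relabel f t) = t"
proof (induction rule: timed_tree.induct)
  case (node ts i)
  have "image_mset (relabel g \<circ> relabel f) ts = image_mset id ts"
    using node by (intro image_mset_cong) auto
  then show ?case using node.prems by (force simp: multiset.map_comp)
qed simp

lemma relabel_in_timed_trees:
  assumes "bij_betw f V W" "t \<in> timed_trees V"
  shows "relabel f t \<in> timed_trees W"
proof -
  have "image_mset f (mset_set V) = mset_set W"
    using assms(1) by (simp add: bij_betw_def image_mset_mset_set)
  then show ?thesis
    using assms(2) by (simp add: timed_trees_def timed_tree_relabel leaf_vertices_relabel)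
qed

text \<open>
  Needed across types: the blocks of a partition serve as the vertices of a smaller tree.
\<close>

lemma bij_betw_timed_trees:
  assumes "finite V" "finite W" "card V = card W"
  shows "\<exists>F. bij_betw F (timed_trees V) (timed_trees W)"
proof -
  obtain f where f: "bij_betw f V W"
    using finite_same_card_bij[OF assms] by blast
  let ?g = "inv_into V f"
  have g: "bij_betw ?g W V" by (rule bij_betw_inv_into[OF f])
  have "relabel ?g (relabel f t) = t" if "t \<in> timed_trees V" for t
    using that vset_timed_trees[OF assms(1) that] f
    by (intro relabel_inverse) (auto simp: timed_trees_def bij_betw_def)
  moreover have "relabel f (relabel ?g t) = t" if "t \<in> timed_trees W" for t
    using that vset_timed_trees[OF assms(2) that] f
    by (intro relabel_inverse) (auto simp: timed_trees_def bij_betw_def f_inv_into_f)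
  ultimately have "bij_betw (relabel f) (timed_trees V) (timed_trees W)"
    using relabel_in_timed_trees[OF f] relabel_in_timed_trees[OF g]
    by (intro bij_betw_byWitness[where f' = "relabel ?g"]) auto
  then show ?thesis by blast
qed

lemma card_timed_trees:
  assumes "finite V"
  shows "card (timed_trees V) = card (timed_trees {..<card V})"
proof -
  obtain F where "bij_betw F (timed_trees V) (timed_trees {..<card V})"
    using bij_betw_timed_trees[of V "{..<card V}"] assms by auto
  then show ?thesis by (rule bij_betw_same_card)
qed

section \<open>Splitting off the first time step\<close>

text \<open>
  The first time step on a block: nothing happens to a singleton, a larger block is glued at once.
\<close>

definition block_tree :: "'v set \<Rightarrow> 'v ltree" where
  "block_tree B = (if is_singleton B then LNode (B, 0) {#}
     else LNode (B, 1) (image_mset (\<lambda>v. LNode ({v}, 0) {#}) (mset_set B)))"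

text \<open>
  Leaves become blocks, and all later times move up by one to make room for the first time step.
\<close>

primrec expand :: "'v set ltree \<Rightarrow> 'v ltree" where
  "expand (LNode l ts) = (if ts = {#} then block_tree (\<Union>(fst l))
     else LNode (\<Union>(fst l), Suc (snd l)) (image_mset expand ts))"

text \<open>
  Cutting the tree off at time \<open>1\<close>: what is there at this time becomes a vertex. Vertex sets are
  recomputed from the children, since a set of blocks is not determined by its union alone.
\<close>

primrec contract :: "'v ltree \<Rightarrow> 'v set ltree" where
  "contract (LNode l ts) = (if snd l \<le> 1 then LNode ({fst l}, 0) {#}
     else LNode (\<Union>(set_mset (image_mset vset (image_mset contract ts))), snd l - 1)
            (image_mset contract ts))"

lemma vset_block_tree [simp]: "vset (block_tree B) = B"
  by (simp add: block_tree_def)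

lemma stage_block_tree: "stage (block_tree B) = (if is_singleton B then 0 else 1)"
  by (simp add: block_tree_def)

lemma leaf_vertices_block_tree:
  "finite B \<Longrightarrow> B \<noteq> {} \<Longrightarrow> leaf_vertices (block_tree B) = mset_set B"
  by (auto simp: block_tree_def multiset.map_comp o_def mset_set_empty_iff)

lemma timed_tree_block_tree:
  assumes "finite B" "B \<noteq> {}"
  shows "timed_tree (block_tree B)"
proof (cases "is_singleton B")
  case False
  then have "2 \<le> card B"
    using assms by (metis One_nat_def Suc_1 Suc_leI card_gt_0_iff is_singleton_altdef nat_less_le)
  then show ?thesis using False assms
    by (auto simp: block_tree_def timed_tree_node_iff mset_set_empty_iff)
qed (simp add: block_tree_def)

lemma stages_block_tree:
  "finite B \<Longrightarrow> B \<noteq> {} \<Longrightarrow> stages (block_tree B) = (if is_singleton B then {0} else {0, 1})"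
  by (auto simp: block_tree_def)

lemma vset_expand [simp]: "vset (expand s) = \<Union>(vset s)"
  by (cases s) simp

lemma stage_expand:
  "stage (expand s) = (if children s = {#} then (if is_singleton (\<Union>(vset s)) then 0 else 1)
     else Suc (stage s))"
  by (cases s) (simp add: stage_block_tree)

text \<open>
  The time of the root of \<open>expand s\<close> tells whether \<open>s\<close> is a leaf: it is at most \<open>1\<close> in this case and at
  least \<open>2\<close> otherwise. A leaf is recovered from its block. For an internal node the children are
  recovered recursively, and they determine the vertex set.
\<close>

lemma expand_inject:
  "timed_tree s \<Longrightarrow> timed_tree s' \<Longrightarrow> expand s = expand s' \<Longrightarrow> s = s'"
proof (induction arbitrary: s' rule: timed_tree.induct)
  case (leaf B)
  then have "stage (expand s') \<le> 1"
    by (simp flip: leaf.prems(2) add: stage_block_tree)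
  then have "children s' = {#}"
    using leaf.prems(1) by (auto simp: stage_expand stage_zero_iff_leaf split: if_splits)
  with leaf.prems(1) obtain C where "s' = LNode ({C}, 0) {#}"
    by (cases rule: timed_tree.cases) auto
  with leaf.prems(2) have "vset (block_tree B) = vset (block_tree C)" by simp
  then show ?case using \<open>s' = _\<close> by simp
next
  case (node ts i)
  then obtain c where c: "c \<in># ts" by fastforce
  with node have "i > 0" "ts \<noteq> {#}" by auto
  let ?s = "LNode (\<Union>c\<in>set_mset ts. vset c, i) ts"
  have "stage (expand ?s) = Suc i" using \<open>ts \<noteq> {#}\<close> by simp
  then have stage: "stage (expand s') = Suc i" using node.prems(2) by metis
  with \<open>i > 0\<close> have "children s' \<noteq> {#}" by (auto simp: stage_expand split: if_splits)
  with node.prems(1) obtain ts' where s': "s' = LNode (\<Union>c\<in>set_mset ts'. vset c, i) ts'"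
    and ts': "ts' \<noteq> {#}" "\<forall>c\<in>#ts'. timed_tree c"
    using stage by (cases rule: timed_tree.cases) auto
  have "image_mset expand ts = image_mset expand ts'"
    using node.prems(2) s' ts' \<open>ts \<noteq> {#}\<close> by simp
  moreover have "c = c'" if "c \<in># ts" "c' \<in># ts'" "expand c = expand c'" for c c'
    using that node.IH ts' by blast
  ultimately have "ts = ts'" by (rule multiset.inj_map_strong[rotated]) 
  then show ?case using s' by simp
qed

lemma timed_tree_expand:
  assumes "timed_tree s" "\<forall>B\<in>vset s. finite B \<and> B \<noteq> {}"
  shows "timed_tree (expand s)"
  using assms
proof (induction rule: timed_tree.induct)
  case (node ts i)
  then obtain c where c: "c \<in># ts" by fastforce
  with node have "i > 0" "ts \<noteq> {#}" by auto
  then show ?case using node by (auto simp: timed_tree_node_iff stage_expand)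
qed (simp add: timed_tree_block_tree)

lemma leaf_vertices_expand:
  assumes "timed_tree s" "\<forall>B\<in>vset s. finite B \<and> B \<noteq> {}"
  shows "leaf_vertices (expand s) = (\<Sum>B\<in>#leaf_vertices s. mset_set B)"
  using assms
proof (induction rule: timed_tree.induct)
  case (node ts i)
  then have "ts \<noteq> {#}" by auto
  moreover have "image_mset (leaf_vertices \<circ> expand) ts =
      image_mset (\<lambda>c. \<Sum>B\<in>#leaf_vertices c. mset_set B) ts"
    using node by (intro image_mset_cong) auto
  moreover have "(\<Sum>c\<in>#ts. \<Sum>B\<in>#leaf_vertices c. mset_set B) =
      (\<Sum>B\<in># (\<Sum>\<^sub># (image_mset leaf_vertices ts)). mset_set B)"
    by (induction ts) auto
  ultimately show ?case by (simp add: multiset.map_comp)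
qed (simp add: leaf_vertices_block_tree)

text \<open>
  Time \<open>0\<close> occurs at the leaves, time \<open>1\<close> occurs iff some block is glued, and the later times are those
  of the internal nodes of \<open>s\<close>.
\<close>

lemma stages_expand:
  assumes "timed_tree s" "\<forall>B\<in>vset s. finite B \<and> B \<noteq> {}"
  shows "stages (expand s) =
    {0} \<union> (if \<forall>B\<in>vset s. is_singleton B then {} else {1}) \<union> Suc ` (stages s - {0})"
  using assms
proof (induction rule: timed_tree.induct)
  case (node ts i)
  then obtain c where c: "c \<in># ts" by fastforce
  with node have "i > 0" "ts \<noteq> {#}" by auto
  have "stages (expand (LNode (\<Union>c\<in>set_mset ts. vset c, i) ts)) =
     insert (Suc i) (\<Union>c\<in>set_mset ts. {0} \<union> (if \<forall>B\<in>vset c. is_singleton B then {} else {1})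
        \<union> Suc ` (stages c - {0}))"
    using node \<open>ts \<noteq> {#}\<close> by (auto simp: image_image)
  also have "\<dots> = {0} \<union> (if \<forall>B\<in>(\<Union>c\<in>set_mset ts. vset c). is_singleton B then {} else {1}) \<union>
     Suc ` (stages (LNode (\<Union>c\<in>set_mset ts. vset c, i) ts) - {0})"
    using c \<open>i > 0\<close> by (auto split: if_splits)
  finally show ?case by simp
qed (auto simp: stages_block_tree)

lemma stage_contract: "stage (contract t) = stage t - 1"
  by (cases t) simp

lemma timed_tree_contract: "timed_tree t \<Longrightarrow> timed_tree (contract t)"
proof (induction rule: timed_tree.induct)
  case (node ts i)
  then have "ts \<noteq> {#}" by auto
  with node show ?case by (force simp: timed_tree_node_iff stage_contract)
qed simp

lemma contract_vset:
  "timed_tree t \<Longrightarrow> \<forall>B\<in>vset (contract t). finite B \<and> B \<noteq> {}"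
proof (induction rule: timed_tree.induct)
  case (node ts i)
  let ?t = "LNode (\<Union>c\<in>set_mset ts. vset c, i) ts"
  have "timed_tree ?t" using node by (intro timed_tree.node) auto
  then have "finite (vset ?t)" "vset ?t \<noteq> {}"
    by (metis finite_set_mset set_leaf_vertices,
        metis leaf_vertices_nonempty set_leaf_vertices set_mset_eq_empty_iff)
  then show ?case using node by auto
qed simp

text \<open>
  The interesting case is a node at time \<open>1\<close>. Its children are leaves, and since no vertex occurs
  twice, they are determined by the vertex set, so \<open>block_tree\<close> restores them.
\<close>

lemma expand_contract:
  assumes "timed_tree t" "\<And>v. count (leaf_vertices t) v \<le> 1"
  shows "expand (contract t) = t"
  using assms
proof (induction rule: timed_tree.induct)
  case (leaf v)
  then show ?case by (simp add: block_tree_def)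
next
  case (node ts i)
  let ?U = "\<Union>c\<in>set_mset ts. vset c"
  let ?t = "LNode (?U, i) ts"
  have t: "timed_tree ?t" using node by (intro timed_tree.node) auto
  from node.hyps have ts: "ts \<noteq> {#}" by auto
  with node.IH have "i > 0" by fastforce
  \<comment> \<open>Only nodes at time \<open>1\<close> lose their children under \<open>contract\<close>.\<close>
  show ?case
  proof (cases "i = 1")
    case True
    have leaf: "\<exists>v. c = LNode ({v}, 0) {#}" if "c \<in># ts" for c
    proof -
      have "timed_tree c" "stage c = 0" using node.IH that True by auto
      then show ?thesis by (metis timed_tree_stage_zero)
    qed
    have "image_mset (\<lambda>v. LNode ({v}, 0) {#}) (leaf_vertices c) = {#c#}" if "c \<in># ts" for c
      using leaf[OF that] by auto
    then have "image_mset (\<lambda>v. LNode ({v}, 0) {#}) (\<Sum>\<^sub># (image_mset leaf_vertices ts)) = ts"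
      by (induction ts) auto
    then have 1: "image_mset (\<lambda>v. LNode ({v}, 0) {#}) (leaf_vertices ?t) = ts"
      using ts by simp
    have 2: "leaf_vertices ?t = mset_set ?U"
    proof (rule multiset_eqI)
      fix v
      have "finite ?U" using set_leaf_vertices[OF t] by (metis finite_set_mset fst_conv ltree.sel(1))
      moreover have "v \<in># leaf_vertices ?t \<longleftrightarrow> v \<in> ?U"
        using set_leaf_vertices[OF t] by (simp del: leaf_vertices.simps)
      ultimately show "count (leaf_vertices ?t) v = count (mset_set ?U) v"
        using node.prems[of v]
        by (cases "v \<in> ?U")
          (auto simp: count_mset_set' le_antisym not_in_iff simp flip: count_greater_zero_iff
             simp del: leaf_vertices.simps)
    qed
    have "size ts = card ?U" using arg_cong[OF 1, of size] 2 by simp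
    then have "\<not> is_singleton ?U" using node.hyps by (auto simp: is_singleton_altdef)
    then show ?thesis using True 1 2 by (simp add: block_tree_def)
  next
    case False
    have ec: "expand (contract c) = c" if c: "c \<in># ts" for c
    proof -
      have "count (leaf_vertices c) v \<le> 1" for v
        using node.prems[of v] mset_subset_eq_count[OF leaf_vertices_child[OF c], of v] le_trans
        by blast
      then show ?thesis using node.IH c by blast
    qed
    then have *: "image_mset (expand \<circ> contract) ts = image_mset id ts"
      by (intro image_mset_cong) simp
    have "\<Union>(vset (contract c)) = vset c" if "c \<in># ts" for c
      using vset_expand[of "contract c"] ec[OF that] by simp
    then have "(\<Union>c\<in>set_mset ts. \<Union>(vset (contract c))) = ?U" by simp
    moreover have "\<Union>(\<Union>c\<in>set_mset ts. vset (contract c)) = (\<Union>c\<in>set_mset ts. \<Union>(vset (contract c)))"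
      by blast
    ultimately have "\<Union>(\<Union>c\<in>set_mset ts. vset (contract c)) = ?U" by (rule trans[rotated])
    then show ?thesis using * \<open>i > 0\<close> False ts by (simp add: multiset.map_comp image_image)
  qed
qed

text \<open>
  As \<open>P\<close> has fewer blocks than \<open>V\<close> has elements, some block is glued at time \<open>1\<close>, so expansion leaves no
  gap between time \<open>0\<close> and the shifted times.
\<close>

lemma expand_in_timed_trees:
  assumes "finite V" "partition_on V P" "card P < card V" "s \<in> timed_trees P"
  shows "expand s \<in> timed_trees V"
proof -
  have P: "finite P" "\<forall>B\<in>P. finite B \<and> B \<noteq> {}"
    using assms finite_elements partition_on_elem by blast+
  have s: "timed_tree s" "leaf_vertices s = mset_set P" "{..stage s} \<subseteq> stages s"
    using assms(4) by (auto simp: timed_trees_def)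
  have [simp]: "vset s = P" using vset_timed_trees[OF P(1) assms(4)] .
  have nonsingle: "\<not> (\<forall>B\<in>P. is_singleton B)"
    using assms card_partition_less_iff by blast
  have "leaf_vertices (expand s) = mset_set V"
    using leaf_vertices_expand[OF s(1)] P s(2) assms(2) sum_mset_set_disjoint[of P]
    by (simp add: partition_on_def)
  moreover have "timed_tree (expand s)"
    using timed_tree_expand[OF s(1)] P by simp
  moreover have "i \<in> stages (expand s)" if "i \<le> stage (expand s)" for i
  proof -
    have "i \<le> Suc (stage s)" using that by (auto simp: stage_expand split: if_splits)
    moreover have "stages (expand s) = {0, 1} \<union> Suc ` (stages s - {0})"
      using stages_expand[OF s(1)] P nonsingle by auto
    ultimately show ?thesis using s(3)
      by (cases i) (auto simp: image_iff)
  qed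
  ultimately show ?thesis by (auto simp: timed_trees_def)
qed

text \<open>
  The partition is the vertex set of \<open>contract t\<close>. It is not the partition into singletons because time
  \<open>1\<close> occurs in \<open>t\<close>.
\<close>

lemma contract_in_timed_trees:
  assumes "finite V" "2 \<le> card V" "t \<in> timed_trees V"
  obtains P where "partition_on V P" "card P < card V" "contract t \<in> timed_trees P"
    "expand (contract t) = t"
proof
  define s where "s = contract t"
  have t: "timed_tree t" "leaf_vertices t = mset_set V" "{..stage t} \<subseteq> stages t"
    using assms(3) by (auto simp: timed_trees_def)
  have s: "timed_tree s" "\<forall>B\<in>vset s. finite B \<and> B \<noteq> {}"
    using timed_tree_contract contract_vset t(1) by (auto simp: s_def)
  show st: "expand (contract t) = t"
    using t assms(1) by (intro expand_contract) (auto simp: count_mset_set')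
  then have es: "expand s = t" by (simp add: s_def)
  have set: "set_mset (leaf_vertices s) = vset s" by (rule set_leaf_vertices[OF s(1)])
  have sum: "(\<Sum>B\<in>#leaf_vertices s. mset_set B) = mset_set V"
    using leaf_vertices_expand[OF s] t(2) es by simp
  show part: "partition_on V (vset s)"
    using partition_if_sum_mset_set(1)[OF _ sum assms(1)] s(2) set by simp
  have lv: "leaf_vertices s = mset_set (vset s)"
    using partition_if_sum_mset_set(2)[OF _ sum assms(1)] s(2) set by simp
  have "stage t \<noteq> 0"
  proof
    assume "stage t = 0"
    then obtain v where "t = LNode ({v}, 0) {#}" using timed_tree_stage_zero t(1) by metis
    then have "{#v#} = mset_set V" using t(2) by simp
    then have "card V = 1" by (metis size_mset_set size_single)
    then show False using assms(2) by simp
  qed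
  then have "1 \<in> stages (expand s)" using t(3) es by auto
  then have "\<not> (\<forall>B\<in>vset s. is_singleton B)"
    using stages_expand[OF s] by (auto split: if_splits)
  then show "card (vset s) < card V"
    using card_partition_less_iff[OF assms(1) part] by simp
  have "i \<in> stages s" if "i \<le> stage s" for i
  proof (cases "i = 0")
    case True
    then show ?thesis using zero_in_stages s(1) by simp
  next
    case False
    then have "Suc i \<le> stage t" using that by (simp add: s_def stage_contract)
    then have "Suc i \<in> stages (expand s)" using t(3) es by auto
    then show ?thesis using stages_expand[OF s] False by (auto split: if_splits)
  qed
  then show "contract t \<in> timed_trees (vset s)"
    using s(1) lv by (auto simp: timed_trees_def s_def)
qed

lemma bij_betw_expand:
  assumes "finite V" "2 \<le> card V"
  shows "bij_betw expand (\<Union>P\<in>{P. partition_on V P \<and> card P < card V}. timed_trees P) (timed_trees V)"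
  unfolding bij_betw_def
proof (intro conjI equalityI subsetI)
  show "inj_on expand (\<Union>P\<in>{P. partition_on V P \<and> card P < card V}. timed_trees P)"
    by (intro inj_onI) (auto simp: timed_trees_def intro: expand_inject)
  fix t assume "t \<in> timed_trees V"
  then obtain P where "partition_on V P" "card P < card V" "contract t \<in> timed_trees P"
    "expand (contract t) = t"
    using contract_in_timed_trees[OF assms] by metis
  then show "t \<in> expand ` (\<Union>P\<in>{P. partition_on V P \<and> card P < card V}. timed_trees P)"
    by (intro image_eqI[of _ _ "contract t"]) auto
next
  fix t assume "t \<in> expand ` (\<Union>P\<in>{P. partition_on V P \<and> card P < card V}. timed_trees P)"
  then show "t \<in> timed_trees V" using expand_in_timed_trees[OF assms(1)] by blast
qed

section \<open>The recurrence\<close>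

text \<open>
  The bijection exhibits the trees on \<open>n\<close> vertices as a finite union of sets of trees on fewer vertices.
  The induction runs over initial segments of the natural numbers, because the type of the vertices
  changes in every step.
\<close>

lemma finite_timed_trees:
  assumes "finite V" "V \<noteq> {}"
  shows "finite (timed_trees V)"
proof -
  have "0 < n \<Longrightarrow> finite (timed_trees {..<n})" for n :: nat
  proof (induction n rule: less_induct)
    case (less n)
    show ?case
    proof (cases "n = 1")
      case True
      then have "{..<n} = {0}" by auto
      then show ?thesis by (simp add: timed_trees_singleton)
    next
      case False
      let ?Ps = "{P. partition_on {..<n} P \<and> card P < card {..<n}}"
      have "finite (timed_trees P)" if "P \<in> ?Ps" for P
      proof -
        have "finite P" "0 < card P"
          using that card_partition_pos[of "{..<n}"] less.prems finite_elements[of "{..<n}"] by auto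
        moreover have "finite (timed_trees {..<card P})"
          using that less.IH \<open>0 < card P\<close> by simp
        moreover obtain F where "bij_betw F (timed_trees P) (timed_trees {..<card P})"
          using bij_betw_timed_trees[of P "{..<card P}"] \<open>finite P\<close> by auto
        ultimately show ?thesis by (simp add: bij_betw_finite)
      qed
      moreover have "finite ?Ps" using finitely_many_partition_on[of "{..<n}"] by simp
      ultimately have "finite (\<Union>P\<in>?Ps. timed_trees P)" by blast
      moreover have "bij_betw expand (\<Union>P\<in>?Ps. timed_trees P) (timed_trees {..<n})"
        using False less.prems by (intro bij_betw_expand) auto
      ultimately show ?thesis by (simp only: bij_betw_finite)
    qed
  qed
  then have "finite (timed_trees {..<card V})"
    using assms by (simp add: card_gt_0_iff)
  moreover obtain F where "bij_betw F (timed_trees V) (timed_trees {..<card V})"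
    using bij_betw_timed_trees[of V "{..<card V}"] assms(1) by auto
  ultimately show ?thesis by (simp add: bij_betw_finite)
qed

text \<open>
  The sets of trees on distinct partitions are disjoint, as a tree determines its vertex set. Grouping
  the partitions by their number of blocks gives the Stirling numbers.
\<close>

lemma card_timed_trees_recurrence:
  assumes "finite V" "2 \<le> card V"
  shows "card (timed_trees V) =
    (\<Sum>j = 1..card V - 1. Stirling (card V) j * card (timed_trees {..<j}))"
proof -
  let ?Ps = "{P. partition_on V P \<and> card P < card V}"
  have V: "V \<noteq> {}" using assms by auto
  have fin: "finite ?Ps" using finitely_many_partition_on[OF assms(1)] by simp
  have finP: "finite P" "0 < card P" if "P \<in> ?Ps" for P
    using that finite_elements[OF assms(1)] card_partition_pos[OF assms(1) V] by auto
  have "card (timed_trees V) = card (\<Union>P\<in>?Ps. timed_trees P)"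
    using bij_betw_same_card[OF bij_betw_expand[OF assms]] by simp
  also have "\<dots> = (\<Sum>P\<in>?Ps. card (timed_trees P))"
  proof (rule card_UN_disjoint[OF fin])
    show "\<forall>P\<in>?Ps. finite (timed_trees P)"
      using finP finite_timed_trees by fastforce
    show "\<forall>P\<in>?Ps. \<forall>Q\<in>?Ps. P \<noteq> Q \<longrightarrow> timed_trees P \<inter> timed_trees Q = {}"
      using finP(1) vset_timed_trees by blast
  qed
  also have "\<dots> = (\<Sum>P\<in>?Ps. card (timed_trees {..<card P}))"
    using finP(1) card_timed_trees by (intro sum.cong) auto
  also have "\<dots> = (\<Sum>j = 1..card V - 1. \<Sum>P\<in>{P \<in> ?Ps. card P = j}. card (timed_trees {..<card P}))"
    using fin finP(2) by (intro sum.group[symmetric]) (auto simp: Suc_le_eq)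
  also have "\<dots> = (\<Sum>j = 1..card V - 1. Stirling (card V) j * card (timed_trees {..<j}))"
  proof (rule sum.cong[OF refl])
    fix j assume "j \<in> {1..card V - 1}"
    then have "{P \<in> ?Ps. card P = j} = {P. partition_on V P \<and> card P = j}" by auto
    then have "card {P \<in> ?Ps. card P = j} = Stirling (card V) j"
      using card_partitions_eq_Stirling[OF assms(1)] by simp
    then show "(\<Sum>P\<in>{P \<in> ?Ps. card P = j}. card (timed_trees {..<card P})) =
        Stirling (card V) j * card (timed_trees {..<j})"
      by simp
  qed
  finally show ?thesis .
qed

theorem proposition4p7:
  shows "a\<^sub>t\<^sup>C (complete_graph 1) = 1 \<and> a\<^sub>t\<^sup>C (complete_graph 2) = 1 \<and>
    (\<forall>n::nat. 3 \<le> n \<longrightarrow>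
      a\<^sub>t\<^sup>C (complete_graph n) = (\<Sum>j = 1..n - 1. Stirling n j * a\<^sub>t\<^sup>C (complete_graph j)))"
proof -
  have one: "a\<^sub>t\<^sup>C (complete_graph 1) = 1"
    by (simp add: num_connected_assembly_trees_complete_graph timed_trees_singleton lessThan_Suc)
  have rec: "a\<^sub>t\<^sup>C (complete_graph n) = (\<Sum>j = 1..n - 1. Stirling n j * a\<^sub>t\<^sup>C (complete_graph j))"
    if "2 \<le> n" for n
  proof -
    have "a\<^sub>t\<^sup>C (complete_graph n) = (\<Sum>j = 1..n - 1. Stirling n j * card (timed_trees {..<j}))"
      using card_timed_trees_recurrence[of "{..<n}"] that
      by (simp add: num_connected_assembly_trees_complete_graph)
    also have "\<dots> = (\<Sum>j = 1..n - 1. Stirling n j * a\<^sub>t\<^sup>C (complete_graph j))"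
      by (intro sum.cong) (auto simp: num_connected_assembly_trees_complete_graph)
    finally show ?thesis .
  qed
  have "a\<^sub>t\<^sup>C (complete_graph 2) = Stirling 2 1 * a\<^sub>t\<^sup>C (complete_graph 1)"
    using rec[of 2] by simp
  also have "Stirling 2 1 = 1" by (simp add: numeral_2_eq_2)
  finally have "a\<^sub>t\<^sup>C (complete_graph 2) = 1" by (simp only: one)
  moreover have "\<forall>n\<ge>3. a\<^sub>t\<^sup>C (complete_graph n) =
      (\<Sum>j = 1..n - 1. Stirling n j * a\<^sub>t\<^sup>C (complete_graph j))"
    by (intro allI impI rec) linarith
  ultimately show ?thesis using one by blast
qed

end
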